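(* For every $\varepsilon>0$ there exists $L\geq 0$ such that the following holds: if the binary expansion of $t\in\mathbb N$ contains at least $L$ blocks of $\mathtt 1$s, then \[c_t>1/2-\varepsilon.\] In particular, for every $\varepsilon>0$ there exist $\delta>0$ and $C>0$ such that for all $T\geq 2$, \[\bigl\lvert\{0\leq t<T:c_t\leq 1/2-\varepsilon\}\bigr\rvert\leq C\log^\delta T.\]
   Context: Here $\mathbb N=\{0,1,2,\dots\}$. Let $s(n)$ denote the binary sum of digits of $n\in\mathbb N$ (the number of $\mathtt 1$s in the base-2 expansion of $n$). For $t\in\mathbb N$, $c_t$ is the asymptotic density \[c_t=\lim_{N\to\infty}\frac1N\bigl\lvert\{0\leq n<N: s(n+t)\geq s(n)\}\bigr\rvert,\] which exists. A block of $\mathtt 1$s in the binary expansion of $t$ is a maximal contiguous run of the digit $\mathtt 1$; e.g. if $t=(\mathtt 1^{m_0}\mathtt 0^{n_0}\mathtt 1^{m_1}\mathtt 0^{n_1}\cdots\mathtt 1^{m_\ell}\mathtt 0^{n_\ell})_2$ with positive $m_i$ and positive $n_i$ for $i<\ell$ (and $n_\ell\geq 0$), then $t$ has $\ell+1$ blocks of $\mathtt 1$s. *)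

theory Defs
  imports Complex_Main
begin

definition binary_digit_sum :: "nat \<Rightarrow> nat" where
  "binary_digit_sum n = card {i. bit n i}"

lemma finite_bits_nat: "finite {i. bit (n :: nat) i}"
proof (rule finite_subset)
  show "{i. bit n i} \<subseteq> {..n}"
  proof
    fix i assume "i \<in> {i. bit n i}"
    then have "n div 2 ^ i \<noteq> 0"
      by (auto simp: bit_iff_odd intro: ccontr)
    then have "2 ^ i \<le> n"
      by (metis div_less not_le)
    then show "i \<in> {..n}"
      using less_le_trans[OF less_exp] by (auto intro: less_imp_le)
  qed
qed simp

definition digit_density :: "nat \<Rightarrow> real" where
  "digit_density t =
     lim (\<lambda>N. real (card {n. n < N \<and> binary_digit_sum (n + t) \<ge> binary_digit_sum n}) / real N)"

text \<open>
  A maximal run of ones is represented by the pair of its lowest and its highest bit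
  position (position \<open>0\<close> being the least significant bit).
\<close>

definition one_blocks :: "nat \<Rightarrow> (nat \<times> nat) set" where
  "one_blocks t = {(a, b). a \<le> b \<and> (\<forall>i\<in>{a..b}. bit t i) \<and>
                     (a = 0 \<or> \<not> bit t (a - 1)) \<and> \<not> bit t (Suc b)}"

lemma finite_one_blocks: "finite (one_blocks t)"
proof (rule finite_subset)
  show "one_blocks t \<subseteq> {i. bit t i} \<times> {i. bit t i}"
    by (auto simp: one_blocks_def)
qed (simp add: finite_bits_nat)

end

theory Submission
  imports Defs "HOL-Probability.Probability"
begin

text \<open>
  Write \<open>X\<^sub>t(n) = s(n+t) - s(n)\<close>. Splitting \<open>n\<close> by parity shows that the values of \<open>X\<^sub>t\<close> are
  distributed like \<open>X\<^bsub>2t\<^esub>\<close>, and that the law of \<open>X\<^bsub>2t+1\<^esub>\<close> is the even mixture of the laws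
  of \<open>X\<^sub>t + 1\<close> and \<open>X\<^bsub>t+1\<^esub> - 1\<close>. The variance \<open>v\<^sub>t\<close> therefore satisfies
  \<open>v\<^bsub>2t\<^esub> = v\<^sub>t\<close>, \<open>v\<^bsub>2t+1\<^esub> = (v\<^sub>t + v\<^bsub>t+1\<^esub>) / 2 + 1\<close>, and it grows at least linearly in the
  number of blocks. The functions \<open>exp (- v\<^sub>t \<theta>\<^sup>2 / 2)\<close> satisfy the recursion of the
  characteristic functions up to \<open>O(\<bar>\<theta>\<bar>\<^sup>3)\<close>; within one block the errors form a
  geometric series, so the total error is \<open>O(v\<^sub>t \<bar>\<theta>\<bar>\<^sup>3)\<close>. Scaling \<open>\<theta>\<close> by \<open>v\<^sub>t\<^sup>-\<^sup>1\<^sup>/\<^sup>2\<close> and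
  applying Levy's continuity theorem gives a central limit theorem as the number of
  blocks tends to infinity, whence \<open>P(X\<^sub>t \<le> 0) \<rightarrow> 1/2\<close>. Finally, \<open>t < 2\<^sup>m\<close> is determined by its set
  of blocks, so only \<open>O(m\<^bsup>2L\<^esup>)\<close> such \<open>t\<close> have at most \<open>L\<close> blocks.
\<close>

section \<open>Digit sums when a binary digit is appended or \<open>t\<close> is added\<close>

lemma binary_digit_sum_double [simp]: "binary_digit_sum (2 * n) = binary_digit_sum n"
proof -
  have "{i. bit (2 * n) i} = Suc ` {i. bit n i}"
    by (auto simp: bit_double_iff image_iff gr0_conv_Suc)
  then show ?thesis by (simp add: binary_digit_sum_def card_image)
qed

lemma binary_digit_sum_Suc_double [simp]: "binary_digit_sum (Suc (2 * n)) = Suc (binary_digit_sum n)"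
proof -
  have "{i. bit (Suc (2 * n)) i} = insert 0 (Suc ` {i. bit n i})"
    by (auto simp: bit_double_iff image_iff gr0_conv_Suc even_bit_succ_iff[of "2*n", simplified])
  then show ?thesis by (simp add: binary_digit_sum_def card_image finite_bits_nat)
qed

lemma binary_digit_sum_Suc_le: "binary_digit_sum (Suc n) \<le> Suc (binary_digit_sum n)"
proof (induction n rule: nat_bit_induct)
  case zero
  show ?case using binary_digit_sum_Suc_double[of 0] by simp
next
  case (odd n)
  then show ?case using binary_digit_sum_double[of "Suc n"] by simp
qed simp

lemma binary_digit_sum_add_le: "binary_digit_sum (n + t) \<le> binary_digit_sum n + t"
proof (induction t)
  case (Suc t)
  then show ?case using binary_digit_sum_Suc_le[of "n + t"] by simp
qed simp

subsection \<open>Natural density\<close>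

definition has_density :: "nat set \<Rightarrow> real \<Rightarrow> bool" where
  "has_density A d \<longleftrightarrow> (\<lambda>N. real (card {n. n < N \<and> n \<in> A}) / real N) \<longlonglongrightarrow> d"

lemma has_density_UNIV: "has_density UNIV 1"
  unfolding has_density_def by (auto intro!: tendsto_eventually eventually_sequentiallyI[of 1])

lemma has_density_empty: "has_density {} 0"
  by (simp add: has_density_def)

lemma has_density_Union_disjoint:
  assumes "finite I" "\<And>i. i \<in> I \<Longrightarrow> has_density (A i) (d i)" "disjoint_family_on A I"
  shows "has_density (\<Union>i\<in>I. A i) (\<Sum>i\<in>I. d i)"
proof -
  have "card {n. n < N \<and> n \<in> (\<Union>i\<in>I. A i)} = (\<Sum>i\<in>I. card {n. n < N \<and> n \<in> A i})" for N
  proof -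
    have "{n. n < N \<and> n \<in> (\<Union>i\<in>I. A i)} = (\<Union>i\<in>I. {n. n < N \<and> n \<in> A i})" by auto
    then show ?thesis
      using assms by (simp add: disjoint_family_on_def card_UN_disjoint disjoint_iff)
  qed
  moreover have "(\<lambda>N. \<Sum>i\<in>I. real (card {n. n < N \<and> n \<in> A i}) / real N) \<longlonglongrightarrow> (\<Sum>i\<in>I. d i)"
    using assms by (intro tendsto_sum) (auto simp: has_density_def)
  ultimately show ?thesis by (simp add: has_density_def sum_divide_distrib)
qed

lemma card_split_parity:
  "card {n. n < N \<and> n \<in> A} =
    card {m. m < Suc N div 2 \<and> m \<in> {m. 2 * m \<in> A}} + card {m. m < N div 2 \<and> m \<in> {m. Suc (2 * m) \<in> A}}"
proof -
  have "{n. n < N \<and> n \<in> A} =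
      (\<lambda>m. 2 * m) ` {m. m < Suc N div 2 \<and> m \<in> {m. 2 * m \<in> A}} \<union>
      (\<lambda>m. Suc (2 * m)) ` {m. m < N div 2 \<and> m \<in> {m. Suc (2 * m) \<in> A}}"
    (is "_ = ?E \<union> ?O")
  proof (intro set_eqI)
    fix n
    show "n \<in> {n. n < N \<and> n \<in> A} \<longleftrightarrow> n \<in> ?E \<union> ?O"
      by (cases "even n") (auto elim!: evenE oddE simp: image_iff)
  qed
  moreover have "?E \<inter> ?O = {}" by (auto; presburger)
  ultimately show ?thesis
    by (simp add: card_Un_disjoint card_image inj_on_def)
qed

lemma half_limits:
  "(\<lambda>N. real (N div 2) / real N) \<longlonglongrightarrow> 1 / 2"
  "(\<lambda>N. real (Suc N div 2) / real N) \<longlonglongrightarrow> 1 / 2"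
proof -
  have lim: "(\<lambda>N. 1 / 2 + 1 / real N) \<longlonglongrightarrow> 1 / 2" "(\<lambda>N. 1 / 2 - 1 / real N) \<longlonglongrightarrow> 1 / 2"
    by real_asymp+
  have bnd: "1 / 2 - 1 / real N \<le> real M / real N \<and> real M / real N \<le> 1 / 2 + 1 / real N"
    if "N \<ge> 1" "M = N div 2 \<or> M = Suc N div 2" for M N :: nat
  proof -
    have "real N \<le> 2 * real M + 1" "2 * real M \<le> real N + 1" using that by linarith+
    then have "(real N / 2 - 1) / real N \<le> real M / real N" "real M / real N \<le> (real N / 2 + 1) / real N"
      by (intro divide_right_mono; linarith)+
    then show ?thesis using that(1) by (simp add: add_divide_distrib diff_divide_distrib)
  qed
  show "(\<lambda>N. real (N div 2) / real N) \<longlonglongrightarrow> 1 / 2"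
    by (rule tendsto_sandwich[OF _ _ lim(2,1)]) (use bnd in \<open>auto intro!: eventually_sequentiallyI[of 1]\<close>)
  show "(\<lambda>N. real (Suc N div 2) / real N) \<longlonglongrightarrow> 1 / 2"
    by (rule tendsto_sandwich[OF _ _ lim(2,1)]) (use bnd in \<open>auto intro!: eventually_sequentiallyI[of 1]\<close>)
qed

text \<open>Even and odd numbers each make up half of an initial segment, so the densities of the
  two parity classes are averaged. This carries the parity recursion of the digit sum difference
  over to densities.\<close>

lemma has_density_parity:
  assumes "has_density {m. 2 * m \<in> A} a" "has_density {m. Suc (2 * m) \<in> A} b"
  shows "has_density A ((a + b) / 2)"
proof -
  define f where "f B M = real (card {m. m < M \<and> m \<in> B})" for B :: "nat set" and M
  let ?E = "{m. 2 * m \<in> A}" and ?O = "{m. Suc (2 * m) \<in> A}"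
  have half: "filterlim (\<lambda>N. N div 2) at_top (sequentially :: nat filter)"
       "filterlim (\<lambda>N. Suc N div 2) at_top (sequentially :: nat filter)"
  proof -
    have "Z \<le> N div 2 \<and> Z \<le> Suc N div 2" if "2 * Z \<le> N" for Z N :: nat
      using that by linarith
    then show "filterlim (\<lambda>N. N div 2) at_top (sequentially :: nat filter)"
       "filterlim (\<lambda>N. Suc N div 2) at_top (sequentially :: nat filter)"
      unfolding filterlim_at_top eventually_sequentially by blast+
  qed
  have "(\<lambda>N. f ?E (Suc N div 2) / real (Suc N div 2)) \<longlonglongrightarrow> a"
       "(\<lambda>N. f ?O (N div 2) / real (N div 2)) \<longlonglongrightarrow> b"
    using filterlim_compose[OF assms(1)[unfolded has_density_def] half(2)]
      filterlim_compose[OF assms(2)[unfolded has_density_def] half(1)] by (simp_all add: f_def)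
  then have "(\<lambda>N. f ?E (Suc N div 2) / real (Suc N div 2) * (real (Suc N div 2) / real N) +
       f ?O (N div 2) / real (N div 2) * (real (N div 2) / real N)) \<longlonglongrightarrow> a * (1 / 2) + b * (1 / 2)"
    by (intro tendsto_intros half_limits)
  \<comment> \<open>The cancellation also covers \<open>M = 0\<close>, because
    \<open>f B 0 = 0\<close>.\<close>
  moreover have "f B M / real M * (real M / x) = f B M / x" for B M x
    by (simp add: f_def)
  ultimately have "(\<lambda>N. f ?E (Suc N div 2) / real N + f ?O (N div 2) / real N)
      \<longlonglongrightarrow> a * (1 / 2) + b * (1 / 2)"
    by (simp only:)
  then show ?thesis
    unfolding has_density_def card_split_parity[of _ A] by (simp add: f_def add_divide_distrib)
qed

subsection \<open>The distribution of the digit sum difference\<close>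

text \<open>The first argument serves even \<open>n\<close>, the second odd \<open>n\<close>: in the
  latter case adding an odd \<open>t\<close> produces a carry, so one digit is lost and the rest is
  shifted by one more.\<close>

definition half_mix :: "int pmf \<Rightarrow> int pmf \<Rightarrow> int pmf" where
  "half_mix p q = bind_pmf (bernoulli_pmf (1 / 2))
     (\<lambda>b. if b then map_pmf (\<lambda>x. x + 1) p else map_pmf (\<lambda>x. x - 1) q)"

lemma pmf_half_mix: "pmf (half_mix p q) k = (pmf p (k - 1) + pmf q (k + 1)) / 2"
proof -
  have "pmf (map_pmf (\<lambda>x. x + 1) p) (k - 1 + 1) = pmf p (k - 1)"
    by (rule pmf_map_inj') (auto simp: inj_def)
  moreover have "pmf (map_pmf (\<lambda>x. x - 1) q) (k + 1 - 1) = pmf q (k + 1)"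
    by (rule pmf_map_inj') (auto simp: inj_def)
  ultimately show ?thesis
    by (simp add: half_mix_def pmf_bind)
qed

text \<open>Written against the counting measure, an expectation is linear in the mass function;
  boundedness of \<open>h\<close> supplies integrability of both parts.\<close>

lemma expectation_half_mix:
  fixes h :: "int \<Rightarrow> complex"
  assumes "\<And>x. norm (h x) \<le> 1"
  shows "measure_pmf.expectation (half_mix p q) h =
    (measure_pmf.expectation p (\<lambda>x. h (x + 1)) + measure_pmf.expectation q (\<lambda>x. h (x - 1))) / 2"
proof -
  define P Q where "P = map_pmf (\<lambda>x. x + 1) p" and "Q = map_pmf (\<lambda>x. x - 1) q"
  have E: "measure_pmf.expectation r h = (\<integral>x. pmf r x *\<^sub>R h x \<partial>count_space UNIV)" for r
    by (simp add: measure_pmf_eq_density integral_density)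
  have I: "integrable (count_space UNIV) (\<lambda>x. pmf r x *\<^sub>R h x)" for r
  proof -
    have "integrable (measure_pmf r) h"
      using assms by (intro measure_pmf.integrable_const_bound[where B = 1]) auto
    then show ?thesis
      by (simp add: measure_pmf_eq_density integrable_density)
  qed
  have "pmf (half_mix p q) x = (pmf P x + pmf Q x) / 2" for x
    by (simp add: half_mix_def pmf_bind P_def Q_def)
  then have "measure_pmf.expectation (half_mix p q) h =
      (\<integral>x. (pmf P x *\<^sub>R h x + pmf Q x *\<^sub>R h x) / 2 \<partial>count_space UNIV)"
    unfolding E by (simp add: scaleR_conv_of_real add_divide_distrib distrib_right)
  also have "\<dots> = (measure_pmf.expectation P h + measure_pmf.expectation Q h) / 2"
    by (simp add: E I)
  finally show ?thesis by (simp add: P_def Q_def)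
qed

text \<open>
  For \<open>t = 1\<close> the recursion is not well-founded, since \<open>1 = 2 * 0 + 1\<close> refers to \<open>0 + 1\<close> itself;
  the shifted geometric distribution is its fixed point.
\<close>

function delta :: "nat \<Rightarrow> int pmf" where
  "delta t = (if t = 0 then return_pmf 0
     else if t = 1 then map_pmf (\<lambda>j. 1 - int j) (geometric_pmf (1 / 2))
     else if even t then delta (t div 2)
     else half_mix (delta (t div 2)) (delta (Suc (t div 2))))"
  by auto
termination by (relation "Wellfounded.measure id") (auto elim: oddE)
declare delta.simps [simp del]

lemma delta_0: "delta 0 = return_pmf 0"
  by (simp add: delta.simps)

lemma delta_double: "delta (2 * t) = delta t"
  by (cases "t = 0") (simp_all add: delta.simps[of "2 * t"] delta_0)

lemma delta_Suc_double: "delta (Suc (2 * t)) = half_mix (delta t) (delta (Suc t))"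
proof (cases "t = 0")
  case True
  have d1: "delta (Suc 0) = map_pmf (\<lambda>j. 1 - int j) (geometric_pmf (1 / 2))"
    by (simp add: delta.simps)
  \<comment> \<open>Condition on the first trial: success means \<open>j = 0\<close> and value
    \<open>0 + 1\<close>; failure replaces \<open>j\<close> by \<open>Suc j\<close>, which lowers
    \<open>1 - int j\<close> by one.\<close>
  have "delta (Suc 0) = half_mix (delta 0) (delta (Suc 0))"
    by (subst d1, subst geometric_bind_pmf_unfold)
      (auto simp: half_mix_def delta_0 d1 map_bind_pmf map_pmf_comp intro!: bind_pmf_cong)
  then show ?thesis using True by simp
next
  case False
  then show ?thesis by (simp add: delta.simps[of "Suc (2 * t)"])
qed

lemma has_density_delta:
  "has_density {n. int (binary_digit_sum (n + t)) - int (binary_digit_sum n) = k} (pmf (delta t) k)"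
proof (induction t arbitrary: k rule: less_induct)
  case (less t)
  define A where "A t k = {n. int (binary_digit_sum (n + t)) - int (binary_digit_sum n) = k}" for t k
  have even: "{m. 2 * m \<in> A (2 * u) k} = A u k" "{m. Suc (2 * m) \<in> A (2 * u) k} = A u k" for u k
    using binary_digit_sum_double[of "_ + u"] binary_digit_sum_Suc_double[of "_ + u"] by (auto simp: A_def)
  have odd: "{m. 2 * m \<in> A (Suc (2 * u)) k} = A u (k - 1)"
    "{m. Suc (2 * m) \<in> A (Suc (2 * u)) k} = A (Suc u) (k + 1)" for u k
    using binary_digit_sum_double[of "Suc (_ + u)"] binary_digit_sum_Suc_double[of "_ + u"] by (auto simp: A_def)
  have zero: "has_density (A 0 k) (pmf (delta 0) k)" for k
    by (cases "k = 0") (auto simp: A_def delta_0 has_density_UNIV has_density_empty)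
  have step: "has_density (A (Suc (2 * u)) k) (pmf (delta (Suc (2 * u))) k)"
    if "has_density (A u (k - 1)) (pmf (delta u) (k - 1))"
      "has_density (A (Suc u) (k + 1)) (pmf (delta (Suc u)) (k + 1))" for u k
    using has_density_parity[of "A (Suc (2 * u)) k"] that
    by (simp add: odd delta_Suc_double pmf_half_mix)
  consider "t = 0" | "t = 1" | u where "t = 2 * u" "u < t" | u where "t = Suc (2 * u)" "Suc u < t"
  proof (cases "even t")
    case True
    then show ?thesis using that(1,3) by (cases "t = 0") (auto elim!: evenE)
  next
    case False
    then obtain u where "t = Suc (2 * u)" by (auto elim: oddE)
    then show ?thesis using that(2,4) by (cases "u = 0") auto
  qed
  then show ?case
  proof cases
    case 1
    then show ?thesis using zero[of k] by (simp add: A_def)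
  next
    case 2
    have large: "has_density (A 1 k) (pmf (delta 1) k)" if "k \<ge> 2" for k
    proof -
      have "int (binary_digit_sum (n + 1)) - int (binary_digit_sum n) < k" for n
        using binary_digit_sum_Suc_le[of n] that by simp
      then have "A 1 k = {}" by (auto simp: A_def order_less_irrefl)
      moreover have "pmf (delta 1) k = 0"
        using that by (simp add: delta.simps pmf_eq_0_set_pmf) auto
      ultimately show ?thesis by (simp add: has_density_empty)
    qed
    \<comment> \<open>For \<open>t = 1\<close> the recursion expresses the value at \<open>k\<close>
      by \<open>t = 1\<close> itself at \<open>k + 1\<close>. Adding one raises the digit sum by at
      most one, so both sides vanish for \<open>k \<ge> 2\<close>, and the induction runs downwards
      from there.\<close>
    have "has_density (A 1 (2 - int j)) (pmf (delta 1) (2 - int j))" for j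
    proof (induction j)
      case (Suc j)
      then show ?case using step[of 0 "1 - int j"] zero[of "- int j"] by simp
    qed (use large in simp)
    moreover have "k = 2 - int (nat (2 - k))" if "k \<le> 2" using that by simp
    ultimately show ?thesis unfolding 2 A_def[symmetric] using large by (metis linear)
  next
    case 3
    then show ?thesis using has_density_parity[of "A t k" "pmf (delta u) k" "pmf (delta u) k"] less.IH[of u k]
      by (simp add: even delta_double A_def[symmetric])
  next
    case 4
    then show ?thesis using step[of u k] less.IH[of u] less.IH[of "Suc u"]
      unfolding A_def[symmetric] by simp
  qed
qed

text \<open>Natural density is only finitely additive. Since the difference never exceeds
  \<open>t\<close>, its nonnegative values are finitely many and their densities may be summed; this
  also shows that the limit exists.\<close>

lemma digit_density_eq: "digit_density t = measure (delta t) {0..}"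
proof -
  let ?X = "\<lambda>n. int (binary_digit_sum (n + t)) - int (binary_digit_sum n)"
  have le: "?X n \<le> int t" for n using binary_digit_sum_add_le[of n t] by linarith
  have "pmf (delta t) k = 0" if "k > int t" for k
  proof -
    have "{n. ?X n = k} = {}" using le that by (smt (verit) Collect_empty_eq)
    then have "has_density {} (pmf (delta t) k)" using has_density_delta[of t k] by simp
    then show ?thesis using has_density_empty unfolding has_density_def by (rule LIMSEQ_unique)
  qed
  then have "set_pmf (delta t) \<subseteq> {..int t}" by (force simp: set_pmf_iff)
  then have "measure (delta t) {0..} = measure (delta t) {0..int t}"
    by (intro measure_eq_AE) (auto simp: AE_measure_pmf_iff)
  also have "\<dots> = (\<Sum>k\<in>{0..int t}. pmf (delta t) k)"
    by (simp add: measure_measure_pmf_finite)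
  finally have eq: "measure (delta t) {0..} = (\<Sum>k\<in>{0..int t}. pmf (delta t) k)" .
  have "has_density (\<Union>k\<in>{0..int t}. {n. ?X n = k}) (\<Sum>k\<in>{0..int t}. pmf (delta t) k)"
    by (intro has_density_Union_disjoint has_density_delta) (auto simp: disjoint_family_on_def)
  moreover have "(\<Union>k\<in>{0..int t}. {n. ?X n = k}) = {n. binary_digit_sum n \<le> binary_digit_sum (n + t)}"
    using le by auto
  ultimately show ?thesis
    unfolding digit_density_def eq has_density_def by (simp add: limI)
qed

subsection \<open>Variance and the number of blocks\<close>

text \<open>The variance of \<open>delta t\<close>, introduced through its recursion. The value 2 at
  \<open>t = 1\<close> solves \<open>v = (0 + v) / 2 + 1\<close>, the one instance where the
  recursion refers to itself.\<close>

function delta_var :: "nat \<Rightarrow> real" where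
  "delta_var t = (if t = 0 then 0 else if t = 1 then 2
     else if even t then delta_var (t div 2)
     else (delta_var (t div 2) + delta_var (Suc (t div 2))) / 2 + 1)"
  by auto
termination by (relation "Wellfounded.measure id") (auto elim: oddE)
declare delta_var.simps [simp del]

lemma delta_var_0: "delta_var 0 = 0"
  by (simp add: delta_var.simps)

lemma delta_var_double: "delta_var (2 * t) = delta_var t"
  by (cases "t = 0") (simp_all add: delta_var.simps[of "2 * t"] delta_var_0)

lemma delta_var_Suc_double:
  "delta_var (Suc (2 * t)) = (delta_var t + delta_var (Suc t)) / 2 + 1"
proof (cases "t = 0")
  case True
  have "delta_var 1 = 2" by (subst delta_var.simps) simp
  then show ?thesis using True by (simp add: delta_var_0)
next
  case False
  then show ?thesis by (simp add: delta_var.simps[of "Suc (2 * t)"])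
qed

text \<open>Representing a block by its top bit makes the effect of appending a low digit easy to
  track: an appended one creates a new top exactly when the digit above it is zero.\<close>

definition run_tops :: "nat \<Rightarrow> nat set" where
  "run_tops t = {i. bit t i \<and> \<not> bit t (Suc i)}"

lemma finite_run_tops: "finite (run_tops t)"
  using finite_subset[OF _ finite_bits_nat[of t]] by (auto simp: run_tops_def)

lemma card_run_tops_double: "card (run_tops (2 * t)) = card (run_tops t)"
proof -
  have "run_tops (2 * t) = Suc ` run_tops t"
    by (auto simp: run_tops_def bit_double_iff image_iff gr0_conv_Suc)
  then show ?thesis by (simp add: card_image)
qed

lemma card_run_tops_Suc_double:
  "card (run_tops (Suc (2 * t))) = card (run_tops t) + (if even t then 1 else 0)"
proof -
  have "run_tops (Suc (2 * t)) = Suc ` run_tops t \<union> (if even t then {0} else {})"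
    by (auto simp: run_tops_def bit_double_iff image_iff gr0_conv_Suc bit_0
        even_bit_succ_iff[of "2*t", simplified])
  then show ?thesis using finite_run_tops by (simp add: card_image)
qed

text \<open>A block is determined by its top: if of two blocks with the same top one began lower, it
  would contain the zero just below the other.\<close>

lemma card_one_blocks_le: "card (one_blocks t) \<le> card (run_tops t)"
proof (rule card_inj_on_le[of snd])
  show "inj_on snd (one_blocks t)"
  proof (rule inj_onI)
    fix p q assume pq: "p \<in> one_blocks t" "q \<in> one_blocks t" "snd p = snd q"
    obtain a a' b where [simp]: "p = (a, b)" "q = (a', b)"
      using pq(3) by (metis prod.collapse)
    have "\<not> x < y" if "(x, b) \<in> one_blocks t" "(y, b) \<in> one_blocks t" for x y
    proof
      assume "x < y"
      then have "y - 1 \<in> {x..b}" "y \<noteq> 0" using that(2) by (auto simp: one_blocks_def)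
      then show False using that by (auto simp: one_blocks_def)
    qed
    then have "\<not> a < a'" "\<not> a' < a" using pq by auto
    then show "p = q" by simp
  qed
  show "snd ` one_blocks t \<subseteq> run_tops t"
    by (auto simp: one_blocks_def run_tops_def)
qed (rule finite_run_tops)

section \<open>Growth of the variance with the number of blocks\<close>

lemma delta_var_nonneg: "delta_var t \<ge> 0"
proof -
  have "delta_var t \<ge> 0 \<and> delta_var (Suc t) \<ge> 0"
  proof (induction t rule: nat_bit_induct)
    case zero
    show ?case using delta_var_Suc_double[of 0] by (simp add: delta_var_0)
  next
    case (even t)
    then show ?case by (simp add: delta_var_double delta_var_Suc_double)
  next
    case (odd t)
    then show ?case using delta_var_double[of "Suc t"] by (simp add: delta_var_Suc_double)
  qed
  then show ?thesis ..
qed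

text \<open>The increment \<open>d\<close> at \<open>t\<close> becomes \<open>d / 2 + 1\<close> at
  \<open>2 * t\<close> and \<open>d / 2 - 1\<close> at \<open>2 * t + 1\<close>; both maps preserve
  the interval from -2 to 2.\<close>

lemma delta_var_increment: "\<bar>delta_var (Suc t) - delta_var t\<bar> \<le> 2"
proof (induction t rule: nat_bit_induct)
  case zero
  show ?case using delta_var_Suc_double[of 0] by (simp add: delta_var_0)
next
  case (even t)
  then show ?case unfolding delta_var_double delta_var_Suc_double add_divide_distrib by linarith
next
  case (odd t)
  then show ?case using delta_var_double[of "Suc t", simplified]
    unfolding delta_var_Suc_double add_divide_distrib by linarith
qed

lemma delta_var_increment_even:
  assumes "even t"
  shows "delta_var t \<le> delta_var (Suc t)"
proof -
  obtain u where "t = 2 * u" using assms by (rule evenE)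
  then show ?thesis using delta_var_increment[of u]
    by (simp only: delta_var_double delta_var_Suc_double add_divide_distrib)
qed

text \<open>With \<open>d\<close> the increment at \<open>t\<close>, appending 0 adds
  \<open>1 - d / 2\<close> to the sum on the right and appending 1 adds \<open>1 + d / 2\<close>.
  Both are nonnegative. A new block arises only when 1 is appended to an even \<open>t\<close>; then
  \<open>d \<ge> 0\<close>, so the sum gains at least one.\<close>

lemma card_run_tops_le_delta_var_sum:
  "real (card (run_tops t)) \<le> delta_var t + delta_var (Suc t)"
proof (induction t rule: nat_bit_induct)
  case zero
  show ?case using delta_var_nonneg by (simp add: run_tops_def)
next
  case (even t)
  then show ?case using delta_var_increment[of t]
    unfolding delta_var_double delta_var_Suc_double card_run_tops_double add_divide_distrib by linarith
next
  case (odd t)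
  then show ?case
    using delta_var_double[of "Suc t", simplified] delta_var_increment[of t] delta_var_increment_even[of t]
    unfolding delta_var_Suc_double card_run_tops_Suc_double add_divide_distrib
    by (cases "even t"; simp; linarith)
qed

lemma card_run_tops_le: "real (card (run_tops t)) \<le> 2 * delta_var t + 2"
  using card_run_tops_le_delta_var_sum[of t] delta_var_increment[of t] by linarith

subsection \<open>Gaussian approximation of the characteristic function\<close>

definition delta_char :: "nat \<Rightarrow> real \<Rightarrow> complex" where
  "delta_char t \<theta> = measure_pmf.expectation (delta t) (\<lambda>k. cis (\<theta> * real_of_int k))"

lemma delta_char_0: "delta_char 0 \<theta> = 1"
  by (simp add: delta_char_def delta_0)

lemma delta_char_double: "delta_char (2 * t) \<theta> = delta_char t \<theta>"
  by (simp add: delta_char_def delta_double)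

lemma delta_char_Suc_double:
  "delta_char (Suc (2 * t)) \<theta> =
    (cis \<theta> * delta_char t \<theta> + cis (- \<theta>) * delta_char (Suc t) \<theta>) / 2"
proof -
  have "cis (\<theta> * real_of_int (k + 1)) = cis \<theta> * cis (\<theta> * real_of_int k)"
       "cis (\<theta> * real_of_int (k - 1)) = cis (- \<theta>) * cis (\<theta> * real_of_int k)" for k
    unfolding cis_mult by (simp_all add: algebra_simps)
  then show ?thesis
    by (simp add: delta_char_def delta_Suc_double expectation_half_mix)
qed

text \<open>Put \<open>w = (a + b) / 2\<close> and \<open>c = (b - a) / 2\<close>. After the factor
  \<open>exp (- w * \<theta>\<^sup>2 / 2)\<close>, which is at most 1, is extracted, the two terms
  are \<open>exp z\<close> and \<open>exp (- z)\<close> with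
  \<open>z = \<i> * \<theta> + c * \<theta>\<^sup>2 / 2\<close>. Their mean is cosh z, which agrees
  with \<open>exp (- \<theta>\<^sup>2 / 2)\<close> up to third order because
  \<open>\<bar>c\<bar> \<le> 1\<close>.\<close>

lemma gaussian_half_mix_error:
  obtains K :: real where "K \<ge> 0"
    "\<And>\<theta> a b. \<lbrakk>\<bar>\<theta>\<bar> \<le> 1; 0 \<le> a; 0 \<le> b; \<bar>b - a\<bar> \<le> 2\<rbrakk> \<Longrightarrow>
      norm ((cis \<theta> * of_real (exp (- a * \<theta>\<^sup>2 / 2)) + cis (- \<theta>) * of_real (exp (- b * \<theta>\<^sup>2 / 2))) / 2
        - of_real (exp (- ((a + b) / 2 + 1) * \<theta>\<^sup>2 / 2)) :: complex) \<le> K * \<bar>\<theta>\<bar> ^ 3"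
proof
  \<comment> \<open>The summands bound, in turn, the Taylor remainder of cosh z, the replacement of
    \<open>z\<^sup>2\<close> by \<open>- \<theta>\<^sup>2\<close>, and the Taylor remainder of the
    Gaussian.\<close>
  define K :: real where "K = exp (3 / 2) * (27 / 16) + 5 / 8 + exp (1 / 2) / 4"
  show "K \<ge> 0" by (simp add: K_def)
  fix \<theta> a b :: real
  assume \<theta>: "\<bar>\<theta>\<bar> \<le> 1" and ab: "0 \<le> a" "0 \<le> b" "\<bar>b - a\<bar> \<le> 2"
  define c w where "c = (b - a) / 2" and "w = (a + b) / 2"
  have c: "\<bar>c\<bar> \<le> 1" and w: "w \<ge> 0" and a_eq: "a = w - c" and b_eq: "b = w + c"
    using ab by (auto simp: c_def w_def field_simps)
  define z :: complex where "z = \<i> * of_real \<theta> + of_real (c * \<theta>\<^sup>2 / 2)"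
  have \<theta>4: "\<theta> ^ 4 \<le> \<bar>\<theta>\<bar> ^ 3"
    using power_decreasing[of 3 4 "\<bar>\<theta>\<bar>"] \<theta> by simp
  have "\<theta>\<^sup>2 \<le> \<bar>\<theta>\<bar>" using power_decreasing[of 1 2 "\<bar>\<theta>\<bar>"] \<theta> by simp
  then have "\<bar>c\<bar> * \<theta>\<^sup>2 \<le> 1 * \<bar>\<theta>\<bar>" using c by (intro mult_mono) auto
  moreover have "norm z \<le> \<bar>\<theta>\<bar> + \<bar>c\<bar> * \<theta>\<^sup>2 / 2"
    unfolding z_def by (rule order_trans[OF norm_triangle_ineq])
      (simp add: norm_mult abs_mult del: of_real_mult of_real_divide)
  ultimately have nz: "norm z \<le> 3 / 2 * \<bar>\<theta>\<bar>" by simp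
  have tz: "norm (exp y - (1 + y + y\<^sup>2 / 2)) \<le> exp (3 / 2) * (27 / 16) * \<bar>\<theta>\<bar> ^ 3"
    if "norm y = norm z" for y :: complex
  proof -
    have "norm (exp y - (1 + y + y\<^sup>2 / 2)) \<le> exp (norm y) * norm y ^ 3 / 2"
      using Taylor_exp_field[of y 2] by (simp add: numeral_eq_Suc)
    also have "\<dots> \<le> exp (3 / 2) * (3 / 2 * \<bar>\<theta>\<bar>) ^ 3 / 2"
      using nz \<theta> that by (intro divide_right_mono mult_mono power_mono) auto
    finally show ?thesis by (simp add: power_mult_distrib power3_eq_cube)
  qed
  have cosh: "norm ((exp z + exp (- z)) / 2 - (1 + z\<^sup>2 / 2)) \<le> exp (3 / 2) * (27 / 16) * \<bar>\<theta>\<bar> ^ 3"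
  proof -
    have "(exp z + exp (- z)) / 2 - (1 + z\<^sup>2 / 2) =
        ((exp z - (1 + z + z\<^sup>2 / 2)) + (exp (- z) - (1 + (- z) + (- z)\<^sup>2 / 2))) / 2"
      by (simp add: field_simps)
    also have "norm \<dots> \<le> (norm (exp z - (1 + z + z\<^sup>2 / 2)) + norm (exp (- z) - (1 + (- z) + (- z)\<^sup>2 / 2))) / 2"
      unfolding norm_divide norm_numeral by (intro divide_right_mono norm_triangle_ineq) simp
    also have "\<dots> \<le> exp (3 / 2) * (27 / 16) * \<bar>\<theta>\<bar> ^ 3"
      using tz[of z] tz[of "- z"] by simp
    finally show ?thesis .
  qed
  have square: "norm ((1 + z\<^sup>2 / 2) - of_real (1 - \<theta>\<^sup>2 / 2)) \<le> 5 / 8 * \<bar>\<theta>\<bar> ^ 3"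
  proof -
    have "(1 + z\<^sup>2 / 2) - of_real (1 - \<theta>\<^sup>2 / 2) =
        \<i> * of_real (c * \<theta> ^ 3 / 2) + of_real (c\<^sup>2 * \<theta> ^ 4 / 8)"
      by (simp add: z_def complex_eq_iff power2_eq_square power3_eq_cube power4_eq_xxxx field_simps)
    also have "norm \<dots> \<le> \<bar>c\<bar> * \<bar>\<theta>\<bar> ^ 3 / 2 + c\<^sup>2 * \<theta> ^ 4 / 8"
      by (rule order_trans[OF norm_triangle_ineq])
        (simp add: norm_mult abs_mult power_abs del: of_real_mult of_real_divide of_real_power)
    also have "\<dots> \<le> 1 * \<bar>\<theta>\<bar> ^ 3 / 2 + 1 * \<bar>\<theta>\<bar> ^ 3 / 8"
      using c \<theta>4 by (intro add_mono divide_right_mono mult_mono) (auto simp: abs_square_le_1)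
    finally show ?thesis by simp
  qed
  have gauss: "norm (of_real (1 - \<theta>\<^sup>2 / 2) - of_real (exp (- \<theta>\<^sup>2 / 2)) :: complex)
      \<le> exp (1 / 2) / 4 * \<bar>\<theta>\<bar> ^ 3"
  proof -
    have "norm (of_real (1 - \<theta>\<^sup>2 / 2) - of_real (exp (- \<theta>\<^sup>2 / 2)) :: complex) =
        \<bar>exp (- \<theta>\<^sup>2 / 2) - (1 + (- \<theta>\<^sup>2 / 2))\<bar>"
      unfolding of_real_diff[symmetric] norm_of_real by (simp add: abs_minus_commute)
    also have "\<dots> \<le> exp (\<theta>\<^sup>2 / 2) * (\<theta>\<^sup>2 / 2)\<^sup>2"
      using Taylor_exp_field[of "- \<theta>\<^sup>2 / 2" 1] by (simp add: numeral_eq_Suc)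
    also have "\<dots> \<le> exp (1 / 2) * (\<theta>\<^sup>2 / 2)\<^sup>2"
      using \<theta> by (intro mult_right_mono) (auto simp: abs_square_le_1)
    also have "\<dots> = exp (1 / 2) / 4 * \<theta> ^ 4"
      by (simp add: power2_eq_square power4_eq_xxxx)
    also have "\<dots> \<le> exp (1 / 2) / 4 * \<bar>\<theta>\<bar> ^ 3"
      using \<theta>4 by (intro mult_left_mono) auto
    finally show ?thesis .
  qed
  have "norm ((exp z + exp (- z)) / 2 - of_real (exp (- \<theta>\<^sup>2 / 2))) \<le> K * \<bar>\<theta>\<bar> ^ 3"
    using norm_triangle_le[OF add_mono[OF norm_triangle_le[OF add_mono[OF cosh square]] gauss]]
    by (simp add: K_def algebra_simps)
  then have main: "exp (- w * \<theta>\<^sup>2 / 2) * norm ((exp z + exp (- z)) / 2 - of_real (exp (- \<theta>\<^sup>2 / 2)))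
      \<le> 1 * (K * \<bar>\<theta>\<bar> ^ 3)"
    using w by (intro mult_mono) auto
  have "cis \<theta> * of_real (exp (- a * \<theta>\<^sup>2 / 2)) = of_real (exp (- w * \<theta>\<^sup>2 / 2)) * exp z"
    unfolding cis_conv_exp exp_of_real[symmetric] exp_add[symmetric] z_def a_eq
    by (rule arg_cong[of _ _ exp]) (simp add: field_simps)
  moreover have "cis (- \<theta>) * of_real (exp (- b * \<theta>\<^sup>2 / 2)) = of_real (exp (- w * \<theta>\<^sup>2 / 2)) * exp (- z)"
    unfolding cis_conv_exp exp_of_real[symmetric] exp_add[symmetric] z_def b_eq
    by (rule arg_cong[of _ _ exp]) (simp add: field_simps)
  moreover have "of_real (exp (- ((a + b) / 2 + 1) * \<theta>\<^sup>2 / 2)) =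
      (of_real (exp (- w * \<theta>\<^sup>2 / 2)) * of_real (exp (- \<theta>\<^sup>2 / 2)) :: complex)"
    unfolding exp_of_real[symmetric] exp_add[symmetric] w_def
    by (rule arg_cong[of _ _ exp]) (simp add: field_simps)
  ultimately have "(cis \<theta> * of_real (exp (- a * \<theta>\<^sup>2 / 2)) + cis (- \<theta>) * of_real (exp (- b * \<theta>\<^sup>2 / 2))) / 2
        - of_real (exp (- ((a + b) / 2 + 1) * \<theta>\<^sup>2 / 2)) =
      of_real (exp (- w * \<theta>\<^sup>2 / 2)) * ((exp z + exp (- z)) / 2 - of_real (exp (- \<theta>\<^sup>2 / 2)))"
    by (simp only:) (simp add: algebra_simps add_divide_distrib)
  then show "norm ((cis \<theta> * of_real (exp (- a * \<theta>\<^sup>2 / 2)) + cis (- \<theta>) * of_real (exp (- b * \<theta>\<^sup>2 / 2))) / 2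
        - of_real (exp (- ((a + b) / 2 + 1) * \<theta>\<^sup>2 / 2)) :: complex) \<le> K * \<bar>\<theta>\<bar> ^ 3"
    using main by (simp only: norm_mult norm_of_real abs_exp_cancel mult_1)
qed

text \<open>
  The error at \<open>t + 1\<close> must be tracked along with that at \<open>t\<close>. Its bound depends on the parity
  of \<open>t\<close> so that it increases only where a new block starts, not with every digit.
\<close>

lemma digit_recursion_error:
  fixes e :: "nat \<Rightarrow> real"
  assumes e0: "e 0 = 0" and double: "\<And>t. e (2 * t) = e t"
    and Suc_double: "\<And>t. e (Suc (2 * t)) \<le> (e t + e (Suc t)) / 2 + k" and "k \<ge> 0"
  shows "e t \<le> 4 * k * card (run_tops t)"
proof -
  have "e t \<le> 4 * k * card (run_tops t) \<and>
      e (Suc t) \<le> 4 * k * card (run_tops t) + (if even t then 2 * k else - 2 * k)"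
  proof (induction t rule: nat_bit_induct)
    case zero
    show ?case using e0 Suc_double[of 0] by (simp add: run_tops_def)
  next
    case (even t)
    then show ?case using Suc_double[of t] \<open>k \<ge> 0\<close>
      unfolding double card_run_tops_double by (cases "even t") (simp_all add: field_simps)
  next
    \<comment> \<open>For even \<open>t\<close> a block is added, and the old bound plus
      \<open>2 * k\<close> at \<open>Suc t\<close> is exactly the new bound minus
      \<open>2 * k\<close>. For odd \<open>t\<close> no block is added, and averaging in the deficit
      \<open>- 2 * k\<close> exactly cancels the fresh error \<open>k\<close>.\<close>
    case (odd t)
    then show ?case using Suc_double[of t] double[of "Suc t"] \<open>k \<ge> 0\<close>
      unfolding card_run_tops_Suc_double by (cases "even t") (simp_all add: field_simps)
  qed
  then show ?thesis ..
qed

text \<open>Since \<open>cis\<close> has modulus 1, the distance to the Gaussian obeys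
  \<open>digit_recursion_error\<close> with \<open>k = K * \<bar>\<theta>\<bar> ^ 3\<close>. The
  resulting number of blocks is at most \<open>2 * delta_var t + 2\<close>, whence the factor
  8.\<close>

lemma delta_char_gaussian_approx:
  obtains C :: real where
    "\<And>\<theta> t. \<bar>\<theta>\<bar> \<le> 1 \<Longrightarrow> norm (delta_char t \<theta> - of_real (exp (- delta_var t * \<theta>\<^sup>2 / 2)))
       \<le> C * (delta_var t + 1) * \<bar>\<theta>\<bar> ^ 3"
proof -
  obtain K :: real where "K \<ge> 0" and K:
    "\<And>\<theta> a b. \<lbrakk>\<bar>\<theta>\<bar> \<le> 1; 0 \<le> a; 0 \<le> b; \<bar>b - a\<bar> \<le> 2\<rbrakk> \<Longrightarrow>
      norm ((cis \<theta> * of_real (exp (- a * \<theta>\<^sup>2 / 2)) + cis (- \<theta>) * of_real (exp (- b * \<theta>\<^sup>2 / 2))) / 2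
        - of_real (exp (- ((a + b) / 2 + 1) * \<theta>\<^sup>2 / 2)) :: complex) \<le> K * \<bar>\<theta>\<bar> ^ 3"
    using gaussian_half_mix_error by metis
  show thesis
  proof (rule that[of "8 * K"])
    fix \<theta> :: real and t assume \<theta>: "\<bar>\<theta>\<bar> \<le> 1"
    define G where "G t = (of_real (exp (- delta_var t * \<theta>\<^sup>2 / 2)) :: complex)" for t
    define e where "e t = norm (delta_char t \<theta> - G t)" for t
    have "e (Suc (2 * t)) \<le> (e t + e (Suc t)) / 2 + K * \<bar>\<theta>\<bar> ^ 3" for t
    proof -
      have "delta_char (Suc (2 * t)) \<theta> - G (Suc (2 * t)) =
          (cis \<theta> * (delta_char t \<theta> - G t) + cis (- \<theta>) * (delta_char (Suc t) \<theta> - G (Suc t))) / 2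
          + ((cis \<theta> * G t + cis (- \<theta>) * G (Suc t)) / 2 - G (Suc (2 * t)))"
        unfolding delta_char_Suc_double
        by (simp add: algebra_simps add_divide_distrib diff_divide_distrib)
      also have "norm \<dots> \<le> norm ((cis \<theta> * (delta_char t \<theta> - G t) + cis (- \<theta>) * (delta_char (Suc t) \<theta> - G (Suc t))) / 2)
          + norm ((cis \<theta> * G t + cis (- \<theta>) * G (Suc t)) / 2 - G (Suc (2 * t)))"
        by (rule norm_triangle_ineq)
      also have "\<dots> \<le> (e t + e (Suc t)) / 2 + K * \<bar>\<theta>\<bar> ^ 3"
      proof (rule add_mono)
        have "norm (cis \<theta> * (delta_char t \<theta> - G t) + cis (- \<theta>) * (delta_char (Suc t) \<theta> - G (Suc t)))
            \<le> e t + e (Suc t)"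
          by (rule order_trans[OF norm_triangle_ineq]) (simp add: norm_mult e_def)
        then show "norm ((cis \<theta> * (delta_char t \<theta> - G t) + cis (- \<theta>) * (delta_char (Suc t) \<theta> - G (Suc t))) / 2)
            \<le> (e t + e (Suc t)) / 2"
          by (simp add: norm_divide)
        show "norm ((cis \<theta> * G t + cis (- \<theta>) * G (Suc t)) / 2 - G (Suc (2 * t))) \<le> K * \<bar>\<theta>\<bar> ^ 3"
          using K[OF \<theta> delta_var_nonneg delta_var_nonneg delta_var_increment, of t]
          unfolding G_def delta_var_Suc_double .
      qed
      finally show ?thesis by (simp add: e_def)
    qed
    then have "e t \<le> 4 * (K * \<bar>\<theta>\<bar> ^ 3) * card (run_tops t)"
      using \<open>K \<ge> 0\<close>
      by (intro digit_recursion_error)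
        (simp_all add: e_def G_def delta_char_0 delta_char_double delta_var_0 delta_var_double)
    also have "\<dots> \<le> 4 * (K * \<bar>\<theta>\<bar> ^ 3) * (2 * delta_var t + 2)"
      using \<open>K \<ge> 0\<close> card_run_tops_le by (intro mult_left_mono) auto
    finally show "norm (delta_char t \<theta> - of_real (exp (- delta_var t * \<theta>\<^sup>2 / 2)))
       \<le> 8 * K * (delta_var t + 1) * \<bar>\<theta>\<bar> ^ 3"
      by (simp add: e_def G_def algebra_simps)
  qed
qed

subsection \<open>The central limit theorem\<close>

text \<open>Symmetry of the density under negation gives the value 1/2, and the absence of an atom
  at 0 gives continuity.\<close>

lemma cdf_std_normal_0:
  "cdf std_normal_distribution 0 = 1 / 2" "isCont (cdf std_normal_distribution) 0"
proof -
  let ?M = std_normal_distribution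
  interpret real_distribution ?M by (rule real_dist_normal_dist)
  have "AE x in lborel. x \<noteq> (0 :: real)" by (rule AE_lborel_singleton)
  then have "emeasure ?M {0} = 0"
    by (subst emeasure_density) (auto simp: nn_integral_0_iff_AE elim!: eventually_mono split: split_indicator)
  then have null: "measure ?M {0} = 0" by (simp add: measure_def)
  then show "isCont (cdf ?M) 0" by (simp add: isCont_cdf)
  have "emeasure ?M {0..} = emeasure ?M {..0}"
  proof -
    have "emeasure ?M {0..} =
        (\<integral>\<^sup>+x. ennreal (std_normal_density x) * indicator {0..} x \<partial>distr lborel borel uminus)"
      by (simp add: emeasure_density lborel_distr_uminus)
    also have "\<dots> = emeasure ?M {..0}"
      by (subst nn_integral_distr)
        (auto simp: emeasure_density std_normal_density_def intro!: nn_integral_cong split: split_indicator)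
    finally show ?thesis .
  qed
  then have "measure ?M {0..} = measure ?M {..0}" by (simp add: measure_def)
  moreover have "measure ?M {0..} = measure ?M {0<..}"
  proof -
    have "{0..} = {0} \<union> {0 :: real<..}" by auto
    then show ?thesis using null finite_measure_Union[of "{0}" "{0<..}"] by simp
  qed
  moreover have "measure ?M {0<..} = 1 - measure ?M {..0}"
    using prob_compl[of "{..0}"] by (auto simp: Compl_eq_Diff_UNIV[symmetric])
  ultimately show "cdf ?M 0 = 1 / 2" by (simp add: cdf_def)
qed

text \<open>At \<open>\<theta> = u / \<sigma> n\<close> the Gaussian approximation has error of
  order \<open>(\<sigma> n)\<^sup>2 / \<sigma> n ^ 3\<close>, which tends to 0, so Levy's theorem
  applies to the rescaled laws.\<close>

lemma delta_nonpos_tendsto_half: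
  assumes v: "filterlim (\<lambda>n. delta_var (t n)) at_top sequentially"
  shows "(\<lambda>n. measure (delta (t n)) {..0}) \<longlonglongrightarrow> 1 / 2"
proof -
  define \<sigma> where "\<sigma> n = sqrt (delta_var (t n))" for n
  define M where "M n = distr (delta (t n)) borel (\<lambda>k. real_of_int k / \<sigma> n)" for n
  obtain C :: real where C: "\<And>\<theta> t. \<bar>\<theta>\<bar> \<le> 1 \<Longrightarrow>
      norm (delta_char t \<theta> - of_real (exp (- delta_var t * \<theta>\<^sup>2 / 2))) \<le> C * (delta_var t + 1) * \<bar>\<theta>\<bar> ^ 3"
    using delta_char_gaussian_approx by metis
  have \<sigma>: "filterlim \<sigma> at_top sequentially"
    unfolding \<sigma>_def using filterlim_compose[OF sqrt_at_top v] .
  have char: "char (M n) u = delta_char (t n) (u / \<sigma> n)" for n u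
    unfolding M_def char_def
    by (subst integral_distr) (auto simp: delta_char_def cis_conv_exp intro!: Bochner_Integration.integral_cong)
  have "weak_conv_m M std_normal_distribution"
  proof (rule levy_continuity)
    show "real_distribution (M n)" for n
      unfolding M_def by (intro prob_space.real_distribution_distr) (simp_all add: measure_pmf.prob_space_axioms)
    show "real_distribution std_normal_distribution" by (rule real_dist_normal_dist)
    fix u :: real
    have ev: "eventually (\<lambda>n. norm (char (M n) u - char std_normal_distribution u)
        \<le> C * \<bar>u\<bar> ^ 3 * (((\<sigma> n)\<^sup>2 + 1) / \<sigma> n ^ 3)) sequentially"
      \<comment> \<open>This threshold makes \<open>\<sigma> n\<close> positive and keeps
        \<open>u / \<sigma> n\<close> in the range where the approximation is valid.\<close>
      using filterlim_at_top[THEN iffD1, OF \<sigma>, rule_format, of "max 1 \<bar>u\<bar>"]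
    proof eventually_elim
      case (elim n)
      then have pos: "\<sigma> n > 0" and le: "\<bar>u / \<sigma> n\<bar> \<le> 1" by (auto simp: field_simps)
      have sq: "delta_var (t n) = (\<sigma> n)\<^sup>2" using delta_var_nonneg by (simp add: \<sigma>_def)
      have "(\<sigma> n)\<^sup>2 * (u / \<sigma> n)\<^sup>2 = u\<^sup>2" using pos by (simp add: power_divide)
      then have "- (\<sigma> n)\<^sup>2 * (u / \<sigma> n)\<^sup>2 / 2 = - (u\<^sup>2) / 2" by simp
      moreover have "C * ((\<sigma> n)\<^sup>2 + 1) * \<bar>u / \<sigma> n\<bar> ^ 3 = C * \<bar>u\<bar> ^ 3 * (((\<sigma> n)\<^sup>2 + 1) / \<sigma> n ^ 3)"
        using pos by (simp add: power_divide)
      ultimately show ?case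
        using C[OF le, of "t n"] unfolding sq by (simp only: char char_std_normal_distribution)
    qed
    have "((\<lambda>s::real. C * \<bar>u\<bar> ^ 3 * ((s\<^sup>2 + 1) / s ^ 3)) \<longlongrightarrow> C * \<bar>u\<bar> ^ 3 * 0) at_top"
      by (intro tendsto_mult tendsto_const) real_asymp
    then have "(\<lambda>n. C * \<bar>u\<bar> ^ 3 * (((\<sigma> n)\<^sup>2 + 1) / \<sigma> n ^ 3)) \<longlonglongrightarrow> 0"
      using filterlim_compose[OF _ \<sigma>] by simp
    then show "(\<lambda>n. char (M n) u) \<longlonglongrightarrow> char std_normal_distribution u"
      using Lim_null_comparison[OF ev] Lim_null by blast
  qed
  then have "(\<lambda>n. cdf (M n) 0) \<longlonglongrightarrow> 1 / 2"
    using cdf_std_normal_0 unfolding weak_conv_m_def weak_conv_def by metis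
  \<comment> \<open>Division by a positive number leaves the event of being nonpositive unchanged,
    so the cdf at 0 needs no lattice correction.\<close>
  moreover have "eventually (\<lambda>n. cdf (M n) 0 = measure (delta (t n)) {..0}) sequentially"
    using filterlim_at_top[THEN iffD1, OF \<sigma>, rule_format, of 1]
  proof eventually_elim
    case (elim n)
    then have "(\<lambda>k. real_of_int k / \<sigma> n) -` {..0} = {..0}"
      by (auto simp: divide_le_0_iff)
    then show ?case by (simp add: M_def cdf_def measure_distr)
  qed
  ultimately show ?thesis by (simp add: tendsto_cong)
qed

lemma digit_density_gt_half_minus:
  assumes "\<epsilon> > 0"
  obtains L where "\<And>t. card (one_blocks t) \<ge> L \<Longrightarrow> digit_density t > 1 / 2 - \<epsilon>"
proof -
  have "\<exists>L. \<forall>t. card (one_blocks t) \<ge> L \<longrightarrow> digit_density t > 1 / 2 - \<epsilon>"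
  proof (rule ccontr)
    assume "\<not> ?thesis"
    then obtain t where t: "\<And>L. card (one_blocks (t L)) \<ge> L" "\<And>L. digit_density (t L) \<le> 1 / 2 - \<epsilon>"
      by (metis not_less)
    have "delta_var (t n) \<ge> (real n - 2) / 2" for n
    proof -
      have "real n \<le> real (card (run_tops (t n)))"
        using t(1)[of n] card_one_blocks_le[of "t n"] by linarith
      then show ?thesis using card_run_tops_le[of "t n"] by simp
    qed
    moreover have "filterlim (\<lambda>n. (real n - 2) / 2) at_top sequentially" by real_asymp
    ultimately have "filterlim (\<lambda>n. delta_var (t n)) at_top sequentially"
      by (auto intro: filterlim_at_top_mono)
    then have "(\<lambda>n. measure (delta (t n)) {..0}) \<longlonglongrightarrow> 1 / 2"
      by (rule delta_nonpos_tendsto_half)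
    \<comment> \<open>The limit theorem controls \<open>{..0}\<close> while the density is the mass
      of \<open>{0..}\<close>. The two half-lines cover everything, so a small mass of one forces a
      large mass of the other.\<close>
    moreover have "measure (delta (t n)) {..0} \<ge> 1 / 2 + \<epsilon>" for n
    proof -
      have "1 = measure (delta (t n)) ({..0} \<union> {0..})"
      proof -
        have "{..0} \<union> {0..} = (UNIV :: int set)" by auto
        then show ?thesis by simp
      qed
      also have "\<dots> \<le> measure (delta (t n)) {..0} + measure (delta (t n)) {0..}"
        by (intro measure_Un_le) auto
      finally show ?thesis using t(2)[of n] by (simp add: digit_density_eq)
    qed
    ultimately have "1 / 2 + \<epsilon> \<le> (1 / 2 :: real)"
      using LIMSEQ_le_const by blast
    then show False using assms by simp
  qed
  then show ?thesis using that by blast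
qed

subsection \<open>Counting integers with few blocks\<close>

text \<open>Extending a one at \<open>i\<close> as far as possible in both directions yields its
  block. Hence \<open>t\<close> can be recovered from its set of blocks, which makes
  \<open>one_blocks\<close> injective in the count below.\<close>

lemma bit_iff_one_blocks: "bit t i \<longleftrightarrow> (\<exists>(a, b) \<in> one_blocks t. a \<le> i \<and> i \<le> b)"
proof
  assume i: "bit t i"
  define b where "b = (LEAST b. i \<le> b \<and> \<not> bit t (Suc b))"
  define a where "a = (LEAST a. a \<le> i \<and> (\<forall>j\<in>{a..i}. bit t j))"
  obtain N where N: "{i. bit t i} \<subseteq> {..N}"
    using finite_bits_nat[of t] by (auto simp: finite_nat_set_iff_bounded_le)
  then have "i \<le> max i N \<and> \<not> bit t (Suc (max i N))" by force
  then have b: "i \<le> b \<and> \<not> bit t (Suc b)" unfolding b_def by (rule LeastI)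
  have b_min: "bit t (Suc j)" if "i \<le> j" "j < b" for j
    using not_less_Least[of j, folded b_def] that unfolding b_def by blast
  have "i \<le> i \<and> (\<forall>j\<in>{i..i}. bit t j)" using i by simp
  then have a: "a \<le> i \<and> (\<forall>j\<in>{a..i}. bit t j)" unfolding a_def by (rule LeastI)
  have a_min: "\<not> bit t (a - 1)" if "a \<noteq> 0"
  proof
    assume "bit t (a - 1)"
    then have "a - 1 \<le> i \<and> (\<forall>j\<in>{a - 1..i}. bit t j)"
    proof (intro conjI ballI)
      show "a - 1 \<le> i" using a by linarith
      fix j assume "j \<in> {a - 1..i}"
      then have "j = a - 1 \<or> j \<in> {a..i}" by auto
      then show "bit t j" using a \<open>bit t (a - 1)\<close> by auto
    qed
    then have "a \<le> a - 1" unfolding a_def by (rule Least_le)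
    then show False using that by simp
  qed
  have "bit t j" if "a \<le> j" "j \<le> b" for j
  proof (cases "j \<le> i")
    case False
    then show ?thesis using b_min[of "j - 1"] that by simp
  qed (use a that in auto)
  then have "(a, b) \<in> one_blocks t" using a b a_min by (auto simp: one_blocks_def)
  then show "\<exists>(a, b) \<in> one_blocks t. a \<le> i \<and> i \<le> b" using a b by blast
qed (auto simp: one_blocks_def)

text \<open>A set of at most \<open>L\<close> blocks is listed by a word of length at most
  \<open>L\<close> over the \<open>m * m\<close> pairs of positions. Each of the
  \<open>Suc L\<close> possible lengths contributes at most \<open>m ^ (2 * L)\<close>
  words.\<close>

lemma card_few_blocks_le:
  assumes "m \<ge> 1"
  shows "card {t. t < 2 ^ m \<and> card (one_blocks t) \<le> L} \<le> Suc L * m ^ (2 * L)"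
proof -
  let ?A = "{..<m} \<times> {..<m}" and ?X = "{t. t < 2 ^ m \<and> card (one_blocks t) \<le> L}"
  let ?Y = "{xs. set xs \<subseteq> ?A \<and> length xs \<le> L}"
  have fin: "finite ?Y" by (rule finite_lists_length_le) simp
  have "inj_on one_blocks ?X"
    by (rule inj_onI) (simp add: bit_eq_iff bit_iff_one_blocks)
  moreover have "one_blocks ` ?X \<subseteq> set ` ?Y"
  proof clarify
    fix t assume t: "t < 2 ^ m" "card (one_blocks t) \<le> L"
    obtain xs where xs: "set xs = one_blocks t" "distinct xs"
      using finite_distinct_list[OF finite_one_blocks] by blast
    have "i < m" if "bit t i" for i
    proof (rule ccontr)
      assume "\<not> i < m"
      then have "t < 2 ^ i" using t(1) by (meson less_le_trans not_less one_le_numeral power_increasing)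
      then show False using that by (simp add: bit_iff_odd)
    qed
    then have "one_blocks t \<subseteq> ?A" by (auto simp: one_blocks_def)
    then have "xs \<in> ?Y" using xs t(2) by (auto simp: distinct_card[symmetric])
    then show "one_blocks t \<in> set ` ?Y" using xs(1) by blast
  qed
  ultimately have "card ?X \<le> card ?Y"
    by (metis (no_types, lifting) card_image card_image_le card_mono fin finite_imageI le_trans)
  also have "\<dots> = (\<Sum>i\<le>L. card ?A ^ i)" by (rule card_lists_length_le) simp
  also have "\<dots> \<le> (\<Sum>i\<le>L. m ^ (2 * L))"
    using assms by (intro sum_mono) (auto simp: power_mult power2_eq_square intro!: power_increasing)
  finally show ?thesis by simp
qed

theorem theorem1:
  shows "(\<forall>\<epsilon>::real. \<epsilon> > 0 \<longrightarrow>
            (\<exists>L::nat. \<forall>t::nat. card (one_blocks t) \<ge> L \<longrightarrow> digit_density t > 1 / 2 - \<epsilon>)) \<and>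
         (\<forall>\<epsilon>::real. \<epsilon> > 0 \<longrightarrow>
            (\<exists>\<delta>::real. \<exists>C::real. \<delta> > 0 \<and> C > 0 \<and>
               (\<forall>T::real. T \<ge> 2 \<longrightarrow>
                  real (card {t::nat. real t < T \<and> digit_density t \<le> 1 / 2 - \<epsilon>})
                    \<le> C * (ln T) powr \<delta>)))"
proof (intro conjI allI impI)
  fix \<epsilon> :: real assume "\<epsilon> > 0"
  then obtain L where L: "\<And>t. card (one_blocks t) \<ge> L \<Longrightarrow> digit_density t > 1 / 2 - \<epsilon>"
    using digit_density_gt_half_minus by blast
  then show "\<exists>L. \<forall>t. card (one_blocks t) \<ge> L \<longrightarrow> digit_density t > 1 / 2 - \<epsilon>" by blast
next
  fix \<epsilon> :: real assume "\<epsilon> > 0"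
  then obtain L0 where L0: "\<And>t. card (one_blocks t) \<ge> L0 \<Longrightarrow> digit_density t > 1 / 2 - \<epsilon>"
    using digit_density_gt_half_minus by blast
  \<comment> \<open>The successor makes the exponent \<open>2 * L\<close> positive even if
    \<open>L0 = 0\<close>.\<close>
  define L where "L = Suc L0"
  define C where "C = real (Suc L) * (2 / ln 2) ^ (2 * L)"
  have "C > 0" by (simp add: C_def)
  moreover have "real (card {t. real t < T \<and> digit_density t \<le> 1 / 2 - \<epsilon>}) \<le> C * ln T powr real (2 * L)"
    if "T \<ge> 2" for T :: real
  proof -
    \<comment> \<open>Rounding up gives \<open>T \<le> 2 ^ m\<close>; as
      \<open>log 2 T \<ge> 1\<close>, it at most doubles the logarithm, which explains the factor
      \<open>2 / ln 2\<close> in \<open>C\<close>.\<close>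
    define m where "m = nat \<lceil>log 2 T\<rceil>"
    have log: "log 2 T \<ge> 1" using that by simp
    then have m: "m \<ge> 1" "log 2 T \<le> real m" "real m \<le> 2 * log 2 T"
      unfolding m_def by linarith+
    have "T \<le> 2 ^ m"
      using that m(2) by (simp add: log_le_iff powr_realpow)
    have "{t. real t < T \<and> digit_density t \<le> 1 / 2 - \<epsilon>} \<subseteq> {t. t < 2 ^ m \<and> card (one_blocks t) \<le> L}"
    proof clarify
      fix t assume t: "real t < T" "digit_density t \<le> 1 / 2 - \<epsilon>"
      then have "real t < 2 ^ m" using \<open>T \<le> 2 ^ m\<close> by linarith
      then have "t < 2 ^ m" by simp
      moreover have "card (one_blocks t) \<le> L" using t(2) L0[of t] unfolding L_def by linarith
      ultimately show "t < 2 ^ m \<and> card (one_blocks t) \<le> L" ..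
    qed
    then have "card {t. real t < T \<and> digit_density t \<le> 1 / 2 - \<epsilon>} \<le> Suc L * m ^ (2 * L)"
      by (intro order_trans[OF card_mono card_few_blocks_le[OF m(1)]]) auto
    then have "real (card {t. real t < T \<and> digit_density t \<le> 1 / 2 - \<epsilon>}) \<le> real (Suc L) * real m ^ (2 * L)"
      by (metis of_nat_le_iff of_nat_mult of_nat_power)
    also have "\<dots> \<le> real (Suc L) * (2 / ln 2 * ln T) ^ (2 * L)"
      using m(3) by (intro mult_left_mono power_mono) (auto simp: log_def)
    also have "\<dots> = C * ln T powr real (2 * L)"
      using that by (subst powr_realpow) (simp_all only: C_def power_mult_distrib mult.assoc ln_gt_zero)
    finally show ?thesis .
  qed
  moreover have "real (2 * L) > 0" by (simp add: L_def)
  ultimately show "\<exists>\<delta> C. \<delta> > 0 \<and> C > 0 \<and> (\<forall>T\<ge>2.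
      real (card {t. real t < T \<and> digit_density t \<le> 1 / 2 - \<epsilon>}) \<le> C * ln T powr \<delta>)"
    by blast
qed

end
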